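(* All $1$-differential $(\mathrm{Vir},d_{0,0})$-modules are precisely the pairs $(V,\delta)$ where $V$ is a $\mathrm{Vir}$-module and $\delta:V\to V$ is a linear map such that $\delta(xv)=-xv$ for all $x\in\mathrm{Vir}$, $v\in V$.
   Context: All spaces and algebras are over $\mathbb{C}$ and all linear maps are $\mathbb{C}$-linear. For a Lie algebra $\mathcal{L}$, a $1$-differential operator on $\mathcal{L}$ is a linear map $d:\mathcal{L}\to\mathcal{L}$ such that $d[x,y]=[d(x),y]+[x,d(y)]+[d(x),d(y)]$ for all $x,y\in\mathcal{L}$. A $1$-differential module over $(\mathcal{L},d)$ is a pair $(V,\delta)$ where $V$ is an $\mathcal{L}$-module and $\delta:V\to V$ is a linear map with $\delta(xv)=d(x)v+x\delta(v)+d(x)\delta(v)$ for all $x\in\mathcal{L}$, $v\in V$. The Virasoro algebra $\mathrm{Vir}$ is the complex Lie algebra with basis $\{L_n, C \mid n\in\mathbb{Z}\}$ and brackets $[L_m,L_n]=(n-m)L_{n+m}+\delta_{n,-m}\frac{m^3-m}{12}C$, $[C,L_m]=0$. The map $d_{0,0}:=-\mathrm{id}_{\mathrm{Vir}}$ is a $1$-differential operator on $\mathrm{Vir}$. *)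

theory Defs
  imports Complex_Main "HOL-Library.Poly_Mapping"
begin

locale lie_algebra = vector_space scale
  for scale :: "complex \<Rightarrow> 'l::ab_group_add \<Rightarrow> 'l" +
  fixes bracket :: "'l \<Rightarrow> 'l \<Rightarrow> 'l"
  assumes linear_bracket_right: "Vector_Spaces.linear scale scale (\<lambda>y. bracket x y)"
    and linear_bracket_left: "Vector_Spaces.linear scale scale (\<lambda>x. bracket x y)"
    and bracket_self: "bracket x x = 0"
    and jacobi: "bracket x (bracket y z) + bracket y (bracket z x) + bracket z (bracket x y) = 0"

locale lie_module = L: lie_algebra scale bracket + V: vector_space scaleV
  for scale :: "complex \<Rightarrow> 'l::ab_group_add \<Rightarrow> 'l"
    and bracket :: "'l \<Rightarrow> 'l \<Rightarrow> 'l"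
    and scaleV :: "complex \<Rightarrow> 'v::ab_group_add \<Rightarrow> 'v" +
  fixes act :: "'l \<Rightarrow> 'v \<Rightarrow> 'v"
  assumes linear_act_right: "Vector_Spaces.linear scaleV scaleV (\<lambda>v. act x v)"
    and linear_act_left: "Vector_Spaces.linear scale scaleV (\<lambda>x. act x v)"
    and act_bracket: "act (bracket x y) v = act x (act y v) - act y (act x v)"

locale one_differential_operator = lie_algebra scale bracket
  for scale :: "complex \<Rightarrow> 'l::ab_group_add \<Rightarrow> 'l"
    and bracket :: "'l \<Rightarrow> 'l \<Rightarrow> 'l" +
  fixes d :: "'l \<Rightarrow> 'l"
  assumes linear_d: "Vector_Spaces.linear scale scale d"
    and d_bracket: "d (bracket x y) = bracket (d x) y + bracket x (d y) + bracket (d x) (d y)"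

locale one_differential_module =
  one_differential_operator scale bracket d + lie_module scale bracket scaleV act
  for scale :: "complex \<Rightarrow> 'l::ab_group_add \<Rightarrow> 'l"
    and bracket :: "'l \<Rightarrow> 'l \<Rightarrow> 'l"
    and d :: "'l \<Rightarrow> 'l"
    and scaleV :: "complex \<Rightarrow> 'v::ab_group_add \<Rightarrow> 'v"
    and act :: "'l \<Rightarrow> 'v \<Rightarrow> 'v" +
  fixes \<delta> :: "'v \<Rightarrow> 'v"
  assumes linear_delta: "Vector_Spaces.linear scaleV scaleV \<delta>"
    and delta_act: "\<delta> (act x v) = act (d x) v + act x (\<delta> v) + act (d x) (\<delta> v)"

datatype vir_index = Ind_L int | Ind_C

text \<open>Finitely supported functions on the index set: the complex vector space with
  basis indexed by \<^typ>\<open>vir_index\<close>.\<close>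

type_synonym vir = "vir_index \<Rightarrow>\<^sub>0 complex"

definition vir_scale :: "complex \<Rightarrow> vir \<Rightarrow> vir" where
  "vir_scale a x = Poly_Mapping.map ((*) a) x"

definition vir_L :: "int \<Rightarrow> vir" where
  "vir_L n = Poly_Mapping.single (Ind_L n) 1"

definition vir_C :: vir where
  "vir_C = Poly_Mapping.single Ind_C 1"

fun vir_basis_bracket :: "vir_index \<Rightarrow> vir_index \<Rightarrow> vir" where
  "vir_basis_bracket (Ind_L m) (Ind_L n) =
     vir_scale (of_int (n - m)) (vir_L (n + m))
     + (if n = - m then vir_scale ((of_int m ^ 3 - of_int m) / 12) vir_C else 0)"
| "vir_basis_bracket Ind_C _ = 0"
| "vir_basis_bracket _ Ind_C = 0"

text \<open>Bilinear extension of \<^const>\<open>vir_basis_bracket\<close>; the defining relations are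
  \<open>vir_bracket_L_L\<close> and \<open>vir_bracket_C_L\<close> below.\<close>

definition vir_bracket :: "vir \<Rightarrow> vir \<Rightarrow> vir" where
  "vir_bracket x y =
     (\<Sum>i\<in>Poly_Mapping.keys x. \<Sum>j\<in>Poly_Mapping.keys y.
        vir_scale (Poly_Mapping.lookup x i * Poly_Mapping.lookup y j) (vir_basis_bracket i j))"

definition vir_d00 :: "vir \<Rightarrow> vir" where
  "vir_d00 x = - x"

lemma lookup_vir_scale: "Poly_Mapping.lookup (vir_scale a x) k = a * Poly_Mapping.lookup x k"
  by (simp add: vir_scale_def map.rep_eq when_def)

lemma vector_space_vir: "vector_space vir_scale"
  by unfold_locales (auto intro!: poly_mapping_eqI simp: lookup_vir_scale lookup_add algebra_simps)

interpretation vir: vector_space vir_scale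
  by (rule vector_space_vir)

lemma vir_scale_single:
  "vir_scale a (Poly_Mapping.single k b) = Poly_Mapping.single k (a * b)"
  by (rule poly_mapping_eqI) (simp add: lookup_vir_scale lookup_single when_def)

lemma vir_bracket_single:
  "vir_bracket (Poly_Mapping.single i a) (Poly_Mapping.single j b)
     = vir_scale (a * b) (vir_basis_bracket i j)"
  by (auto simp: vir_bracket_def)

lemma vir_bracket_L_L:
  "vir_bracket (vir_L m) (vir_L n) =
     vir_scale (of_int (n - m)) (vir_L (n + m))
     + (if n = - m then vir_scale ((of_int m ^ 3 - of_int m) / 12) vir_C else 0)"
  by (subst (1 2) vir_L_def) (simp add: vir_bracket_single)

lemma vir_bracket_C_L: "vir_bracket vir_C (vir_L m) = 0"
  by (simp add: vir_L_def vir_C_def vir_bracket_single)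

lemma vir_bracket_add_left: "vir_bracket (x + y) z = vir_bracket x z + vir_bracket y z"
  unfolding vir_bracket_def
  by (rule setsum_keys_plus_distrib) (simp_all add: distrib_right vir.scale_left_distrib sum.distrib)

lemma vir_bracket_swap_sum:
  "vir_bracket x y =
     (\<Sum>j\<in>Poly_Mapping.keys y. \<Sum>i\<in>Poly_Mapping.keys x.
        vir_scale (Poly_Mapping.lookup x i * Poly_Mapping.lookup y j) (vir_basis_bracket i j))"
  unfolding vir_bracket_def by (rule sum.swap)

lemma vir_bracket_add_right: "vir_bracket z (x + y) = vir_bracket z x + vir_bracket z y"
  unfolding vir_bracket_swap_sum
  by (rule setsum_keys_plus_distrib) (simp_all add: distrib_left vir.scale_left_distrib sum.distrib)

lemma vir_induct [case_names single add]:
  fixes x :: vir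
  assumes single: "\<And>k a. P (Poly_Mapping.single k a)"
    and add: "\<And>x y. P x \<Longrightarrow> P y \<Longrightarrow> P (x + y)"
  shows "P x"
proof (induction x rule: update_induct)
  case const
  show ?case using single[of undefined 0] by simp
next
  case (update f a b)
  have "Poly_Mapping.update a b f = f + Poly_Mapping.single a b"
    using update by (intro poly_mapping_eqI)
      (auto simp: lookup_update lookup_add lookup_single when_def in_keys_iff)
  then show ?case using add single update by metis
qed

lemma vir_bracket_scale_left: "vir_bracket (vir_scale a x) y = vir_scale a (vir_bracket x y)"
proof (induction x rule: vir_induct)
  case (single k b)
  show ?case
    by (induction y rule: vir_induct)
      (simp_all add: vir_scale_single vir_bracket_single vir_bracket_add_right
        vir.scale_right_distrib mult.assoc)
qed (simp add: vir.scale_right_distrib vir_bracket_add_left)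

lemma vir_bracket_scale_right: "vir_bracket y (vir_scale a x) = vir_scale a (vir_bracket y x)"
proof (induction x rule: vir_induct)
  case (single k b)
  show ?case
    by (induction y rule: vir_induct)
      (simp_all add: vir_scale_single vir_bracket_single vir_bracket_add_left
        vir.scale_right_distrib mult.left_commute)
qed (simp add: vir.scale_right_distrib vir_bracket_add_right)

lemma vir_basis_bracket_swap: "vir_basis_bracket j i = - vir_basis_bracket i j"
proof (cases i; cases j)
  fix m n assume "i = Ind_L m" "j = Ind_L n"
  then show ?thesis
    by (auto intro!: poly_mapping_eqI simp: lookup_add lookup_vir_scale vir_L_def vir_C_def
        lookup_single when_def field_simps power3_eq_cube)
qed simp_all

lemma vir_bracket_swap: "vir_bracket y x = - vir_bracket x y"
proof (induction x rule: vir_induct)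
  case (single k a)
  show ?case
  proof (induction y rule: vir_induct)
    case (single l b)
    show ?case
      by (simp only: vir_bracket_single vir_basis_bracket_swap[of l k] mult.commute[of b a]
          vir.scale_minus_right)
  qed (simp add: vir_bracket_add_left vir_bracket_add_right)
qed (simp add: vir_bracket_add_left vir_bracket_add_right)

lemma vir_bracket_self: "vir_bracket x x = 0"
proof -
  have "vir_bracket x x + vir_bracket x x = 0"
    using vir_bracket_swap[of x x] by (simp only: eq_neg_iff_add_eq_0)
  then have "Poly_Mapping.lookup (vir_bracket x x) k + Poly_Mapping.lookup (vir_bracket x x) k = 0"
    for k
    by (simp only: lookup_zero flip: lookup_add)
  then have "Poly_Mapping.lookup (vir_bracket x x) k = 0" for k
    by (simp only: mult_eq_0_iff flip: mult_2) simp
  then show ?thesis by (intro poly_mapping_eqI) simp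
qed

lemma vir_bracket_0_right [simp]: "vir_bracket x 0 = 0"
  by (simp add: vir_bracket_def)

lemma vir_bracket_C_right [simp]: "vir_bracket x vir_C = 0"
proof (induction x rule: vir_induct)
  case (single k a)
  then show ?case by (cases k) (simp_all add: vir_C_def vir_bracket_single)
qed (simp add: vir_bracket_add_left)

lemma vir_bracket_C_left [simp]: "vir_bracket vir_C x = 0"
  using vir_bracket_swap[of vir_C x] by simp

lemma vir_jacobi_L:
  "vir_bracket (vir_L l) (vir_bracket (vir_L m) (vir_L n))
     + vir_bracket (vir_L m) (vir_bracket (vir_L n) (vir_L l))
     + vir_bracket (vir_L n) (vir_bracket (vir_L l) (vir_L m)) = 0"
proof -
  have nested: "vir_bracket (vir_L a) (vir_bracket (vir_L b) (vir_L c)) =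
      vir_scale (of_int ((c - b) * (c + b - a))) (vir_L (a + b + c))
      + (if a + b + c = 0 then vir_scale (of_int (c - b) * (of_int a ^ 3 - of_int a) / 12) vir_C
         else 0)" for a b c
    by (auto simp: vir_bracket_L_L vir_bracket_add_right vir_bracket_scale_right add_ac
        vir.scale_right_distrib)
  show ?thesis
  proof (cases "l + m + n = 0")
    case False
    then show ?thesis
      by (simp add: nested add_ac flip: vir.scale_left_distrib) (simp add: algebra_simps)
  next
    case True
    then have n: "n = - l - m" by simp
    show ?thesis
      unfolding nested n
      by (rule poly_mapping_eqI)
        (simp add: lookup_add lookup_vir_scale vir_L_def vir_C_def lookup_single when_def
          field_simps power3_eq_cube)
  qed
qed

lemma vir_single_conv:
  "Poly_Mapping.single k a = vir_scale a (case k of Ind_L n \<Rightarrow> vir_L n | Ind_C \<Rightarrow> vir_C)"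
  by (cases k) (simp_all add: vir_L_def vir_C_def vir_scale_single)

lemma vir_jacobi:
  "vir_bracket x (vir_bracket y z) + vir_bracket y (vir_bracket z x)
     + vir_bracket z (vir_bracket x y) = 0"
  (is "?J x y z = 0")
proof -
  have add: "?J (x + x') y z = ?J x y z + ?J x' y z" "?J x (y + y') z = ?J x y z + ?J x y' z"
    "?J x y (z + z') = ?J x y z + ?J x y z'" for x y z x' y' z'
    by (simp_all add: vir_bracket_add_left vir_bracket_add_right algebra_simps)
  have scale: "?J (vir_scale a x) (vir_scale b y) (vir_scale c z) = vir_scale (a * b * c) (?J x y z)"
    for a b c x y z
    by (simp add: vir_bracket_scale_left vir_bracket_scale_right vir.scale_right_distrib mult_ac)
  show ?thesis
  proof (induction x rule: vir_induct)
    case x: (single i a)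
    show ?case
    proof (induction y rule: vir_induct)
      case y: (single j b)
      show ?case
      proof (induction z rule: vir_induct)
        case z: (single k c)
        show ?case
          unfolding vir_single_conv scale
          by (cases i; cases j; cases k) (simp_all add: vir_jacobi_L)
      qed (simp only: add, simp)
    qed (simp only: add, simp)
  qed (simp only: add, simp)
qed

lemma linear_vir_iff:
  "Vector_Spaces.linear vir_scale vir_scale f \<longleftrightarrow>
     (\<forall>x y. f (x + y) = f x + f y) \<and> (\<forall>a x. f (vir_scale a x) = vir_scale a (f x))"
  by (simp add: linear_iff_module_hom module_hom_iff module_iff_vector_space vector_space_vir)

lemma lie_algebra_vir: "lie_algebra vir_scale vir_bracket"
  by (intro lie_algebra.intro lie_algebra_axioms.intro vector_space_vir)
    (simp_all add: linear_vir_iff vir_bracket_add_left vir_bracket_add_right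
      vir_bracket_scale_left vir_bracket_scale_right vir_bracket_self vir_jacobi)

lemma one_differential_operator_vir_d00:
  "one_differential_operator vir_scale vir_bracket vir_d00"
proof (intro one_differential_operator.intro one_differential_operator_axioms.intro lie_algebra_vir)
  show "Vector_Spaces.linear vir_scale vir_scale vir_d00"
    by (simp add: linear_vir_iff vir_d00_def)
  interpret lie_algebra vir_scale vir_bracket by (rule lie_algebra_vir)
  have l: "vir_bracket (- x) y = - vir_bracket x y" and r: "vir_bracket x (- y) = - vir_bracket x y"
    for x y
    using vir_bracket_scale_left[of "-1"] vir_bracket_scale_right[of _ "-1"] by simp_all
  show "vir_d00 (vir_bracket x y) = vir_bracket (vir_d00 x) y + vir_bracket x (vir_d00 y)
      + vir_bracket (vir_d00 x) (vir_d00 y)" for x y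
    by (simp add: vir_d00_def l r)
qed

end

theory Submission
  imports Defs
begin

text \<open>
  When \<open>d = - id\<close>, the two terms of the compatibility condition that involve \<open>\<delta> v\<close> are
  \<open>x (\<delta> v)\<close> and \<open>d(x) (\<delta> v) = - x (\<delta> v)\<close>. They cancel, so that
  \<open>\<delta> (x v) = d(x) v + x (\<delta> v) + d(x) (\<delta> v)\<close> says nothing but \<open>\<delta> (x v) = - x v\<close>.
  The cancellation comes from linearity of the action in the Lie algebra argument
  (\<open>act_minus_left\<close>). That \<open>- id\<close> is a \<open>1\<close>-differential operator, which a module over the pair
  presupposes, reduces to \<open>- [x,y] = - [x,y] - [x,y] + [x,y]\<close>.
\<close>

lemma (in lie_module) act_minus_left: "act (- x) v = - act x v"
proof -
  interpret left: Vector_Spaces.linear scale scaleV "\<lambda>x. act x v"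
    by (rule linear_act_left)
  show ?thesis by (rule left.neg)
qed

theorem theorem3p4:
  fixes scaleV :: "complex \<Rightarrow> 'v::ab_group_add \<Rightarrow> 'v"
    and act :: "vir \<Rightarrow> 'v \<Rightarrow> 'v"
    and \<delta> :: "'v \<Rightarrow> 'v"
  shows "one_differential_module vir_scale vir_bracket vir_d00 scaleV act \<delta> \<longleftrightarrow>
    lie_module vir_scale vir_bracket scaleV act
    \<and> Vector_Spaces.linear scaleV scaleV \<delta>
    \<and> (\<forall>x v. \<delta> (act x v) = - act x v)"
proof -
  have "(\<delta> (act x v) = act (vir_d00 x) v + act x (\<delta> v) + act (vir_d00 x) (\<delta> v))
      \<longleftrightarrow> \<delta> (act x v) = - act x v"
    if "lie_module vir_scale vir_bracket scaleV act" for x v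
    using lie_module.act_minus_left[OF that] by (simp add: vir_d00_def)
  then show ?thesis
    unfolding one_differential_module_def one_differential_module_axioms_def
    using one_differential_operator_vir_d00 by blast
qed

end
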